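(* For every integer $M\ge2$, global deadline-monotonic (DM) scheduling of arbitrary-deadline sporadic task systems on $M$ identical processors has a speedup bound of $3-\frac1M$ with respect to the optimal schedule. That is, if a task set can be feasibly scheduled on $M$ identical processors of speed $1$, then global DM meets all deadlines of all tasks of that task set on $M$ identical processors of speed $3-\frac1M$.
   Context: Model. A sporadic task $\tau_i$ has worst-case execution time $C_i>0$ (on a speed-1 processor), minimum inter-arrival time $T_i>0$, relative deadline $D_i>0$ and utilization $U_i=C_i/T_i$; it is assumed that $C_i\le D_i$ and $U_i\le1$, with no relation required between $D_i$ and $T_i$ (arbitrary deadlines). Task $\tau_i$ releases an infinite sequence of jobs whose consecutive arrivals are at least $T_i$ apart; a job arriving at $t$ must finish by its absolute deadline $t+D_i$. On processors of speed $s$, each job of $\tau_i$ needs at most $C_i/s$ time units of execution. Preemption and migration cost nothing. At any instant at most one job of each task executes, on at most one processor. A finite task set can be feasibly scheduled on $M$ processors of a given speed if, for every legal job arrival sequence, some multiprocessor schedule meets all deadlines. Global DM is global fixed-priority preemptive scheduling in which tasks with smaller relative deadline have higher priority (ties broken arbitrarily but fixed, giving unique priorities): at each instant, among the tasks having an arrived and unfinished job, the $M$ highest-priority ones (all of them if fewer than $M$) execute; jobs of one task are executed in arrival order. A scheduling algorithm has speedup bound $s$ (with respect to the optimal schedule) if it meets all deadlines of every task set on $M$ processors of speed $s$ whenever that task set can be feasibly scheduled on $M$ processors of speed $1$. *)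

theory Defs
  imports "HOL-Analysis.Analysis"
begin

record task =
  wcet :: real  \<comment> \<open>on a processor of speed 1\<close>
  period :: real  \<comment> \<open>minimum inter-arrival time\<close>
  deadline :: real  \<comment> \<open>relative\<close>

definition utilization :: "task \<Rightarrow> real" where
  "utilization x = wcet x / period x"

definition task_set :: "'i set \<Rightarrow> ('i \<Rightarrow> task) \<Rightarrow> bool" where
  "task_set I \<tau> \<longleftrightarrow> finite I \<and>
     (\<forall>i\<in>I. 0 < wcet (\<tau> i) \<and> 0 < period (\<tau> i) \<and> 0 < deadline (\<tau> i) \<and>
            wcet (\<tau> i) \<le> deadline (\<tau> i) \<and> utilization (\<tau> i) \<le> 1)"

text \<open>The \<open>j\<close>-th job of task \<open>i\<close> is the pair \<open>(i, j)\<close>. Its \<open>cost\<close> is the execution time it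
  actually needs at speed 1, which may be smaller than the worst case.\<close>

record 'i job_seq =
  arrival :: "'i \<Rightarrow> nat \<Rightarrow> real"
  cost :: "'i \<Rightarrow> nat \<Rightarrow> real"

definition legal :: "'i set \<Rightarrow> ('i \<Rightarrow> task) \<Rightarrow> 'i job_seq \<Rightarrow> bool" where
  "legal I \<tau> J \<longleftrightarrow>
     (\<forall>i\<in>I. \<forall>j. arrival J i (Suc j) \<ge> arrival J i j + period (\<tau> i) \<and>
                0 \<le> cost J i j \<and> cost J i j \<le> wcet (\<tau> i))"

text \<open>\<open>\<sigma> t p\<close> is the job that processor \<open>p\<close> executes at time \<open>t\<close>, if any; only the processors
  \<open>p < M\<close> matter.\<close>

type_synonym 'i schedule = "real \<Rightarrow> nat \<Rightarrow> ('i \<times> nat) option"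

definition running :: "nat \<Rightarrow> 'i schedule \<Rightarrow> real \<Rightarrow> ('i \<times> nat) set" where
  "running M \<sigma> t = {x. \<exists>p<M. \<sigma> t p = Some x}"

text \<open>Total time for which a job executes between its arrival and time \<open>t\<close>.\<close>

definition exec_time :: "nat \<Rightarrow> 'i job_seq \<Rightarrow> 'i schedule \<Rightarrow> 'i \<Rightarrow> nat \<Rightarrow> real \<Rightarrow> real" where
  "exec_time M J \<sigma> i j t =
     measure lborel {u \<in> {arrival J i j..<t}. (i, j) \<in> running M \<sigma> u}"

definition finished ::
    "nat \<Rightarrow> real \<Rightarrow> 'i job_seq \<Rightarrow> 'i schedule \<Rightarrow> 'i \<Rightarrow> nat \<Rightarrow> real \<Rightarrow> bool" where
  "finished M s J \<sigma> i j t \<longleftrightarrow> exec_time M J \<sigma> i j t \<ge> cost J i j / s"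

definition pending ::
    "nat \<Rightarrow> real \<Rightarrow> 'i job_seq \<Rightarrow> 'i schedule \<Rightarrow> 'i \<Rightarrow> nat \<Rightarrow> real \<Rightarrow> bool" where
  "pending M s J \<sigma> i j t \<longleftrightarrow> arrival J i j \<le> t \<and> \<not> finished M s J \<sigma> i j t"

text \<open>The last conjunct says both that a task executes at most one job at a time and that it
  does so on at most one processor.\<close>

definition valid_schedule ::
    "nat \<Rightarrow> real \<Rightarrow> 'i set \<Rightarrow> 'i job_seq \<Rightarrow> 'i schedule \<Rightarrow> bool" where
  "valid_schedule M s I J \<sigma> \<longleftrightarrow>
     (\<forall>i\<in>I. \<forall>j. \<forall>p<M. {t. \<sigma> t p = Some (i, j)} \<in> sets lborel) \<and>
     (\<forall>t. \<forall>(i, j) \<in> running M \<sigma> t. i \<in> I \<and> pending M s J \<sigma> i j t) \<and>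
     (\<forall>t i j k. \<forall>p<M. \<forall>q<M. \<sigma> t p = Some (i, j) \<and> \<sigma> t q = Some (i, k) \<longrightarrow> p = q)"

definition meets_deadlines ::
    "nat \<Rightarrow> real \<Rightarrow> 'i set \<Rightarrow> ('i \<Rightarrow> task) \<Rightarrow> 'i job_seq \<Rightarrow> 'i schedule \<Rightarrow> bool" where
  "meets_deadlines M s I \<tau> J \<sigma> \<longleftrightarrow>
     (\<forall>i\<in>I. \<forall>j. finished M s J \<sigma> i j (arrival J i j + deadline (\<tau> i)))"

definition feasible :: "nat \<Rightarrow> real \<Rightarrow> 'i set \<Rightarrow> ('i \<Rightarrow> task) \<Rightarrow> bool" where
  "feasible M s I \<tau> \<longleftrightarrow>
     (\<forall>J. legal I \<tau> J \<longrightarrow> (\<exists>\<sigma>. valid_schedule M s I J \<sigma> \<and> meets_deadlines M s I \<tau> J \<sigma>))"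

text \<open>A scheduling algorithm is given by the schedules it may produce for a job sequence, on a
  given number of processors of a given speed.\<close>

type_synonym 'i algorithm =
  "nat \<Rightarrow> real \<Rightarrow> 'i set \<Rightarrow> ('i \<Rightarrow> task) \<Rightarrow> 'i job_seq \<Rightarrow> 'i schedule \<Rightarrow> bool"

definition alg_meets_deadlines ::
    "'i algorithm \<Rightarrow> nat \<Rightarrow> real \<Rightarrow> 'i set \<Rightarrow> ('i \<Rightarrow> task) \<Rightarrow> bool" where
  "alg_meets_deadlines A M s I \<tau> \<longleftrightarrow>
     (\<forall>J \<sigma>. legal I \<tau> J \<and> A M s I \<tau> J \<sigma> \<longrightarrow> meets_deadlines M s I \<tau> J \<sigma>)"

definition speedup_bound :: "'i algorithm \<Rightarrow> nat \<Rightarrow> real \<Rightarrow> bool" where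
  "speedup_bound A M s \<longleftrightarrow>
     (\<forall>I \<tau>. task_set I \<tau> \<and> feasible M 1 I \<tau> \<longrightarrow> alg_meets_deadlines A M s I \<tau>)"

definition active ::
    "nat \<Rightarrow> real \<Rightarrow> 'i set \<Rightarrow> 'i job_seq \<Rightarrow> 'i schedule \<Rightarrow> real \<Rightarrow> 'i set" where
  "active M s I J \<sigma> t = {i \<in> I. \<exists>j. pending M s J \<sigma> i j t}"

text \<open>Global preemptive fixed-priority scheduling; \<open>(k, i) \<in> r\<close> means that task \<open>k\<close> has higher
  priority than task \<open>i\<close>.\<close>

definition global_fp ::
    "('i \<times> 'i) set \<Rightarrow> nat \<Rightarrow> real \<Rightarrow> 'i set \<Rightarrow> 'i job_seq \<Rightarrow> 'i schedule \<Rightarrow> bool" where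
  "global_fp r M s I J \<sigma> \<longleftrightarrow> valid_schedule M s I J \<sigma> \<and>
     (\<forall>t. running M \<sigma> t =
        {(i, LEAST j. pending M s J \<sigma> i j t) | i.
           i \<in> active M s I J \<sigma> t \<and> card {k \<in> active M s I J \<sigma> t. (k, i) \<in> r} < M})"

definition dm_priority :: "'i set \<Rightarrow> ('i \<Rightarrow> task) \<Rightarrow> ('i \<times> 'i) set \<Rightarrow> bool" where
  "dm_priority I \<tau> r \<longleftrightarrow> strict_linear_order_on I r \<and>
     (\<forall>i\<in>I. \<forall>k\<in>I. deadline (\<tau> i) < deadline (\<tau> k) \<longrightarrow> (i, k) \<in> r)"

text \<open>As \<^const>\<open>alg_meets_deadlines\<close> refers to all schedules that an algorithm may produce, the
  existential quantifier below makes it range over all ways of breaking ties.\<close>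

definition global_dm :: "'i algorithm" where
  "global_dm M s I \<tau> J \<sigma> \<longleftrightarrow> (\<exists>r. dm_priority I \<tau> r \<and> global_fp r M s I J \<sigma>)"

end

theory Submission
  imports Defs
begin

text \<open>
  Let \<open>W\<close> and \<open>W'\<close> be the work done by global DM at speed \<open>s = 3 - 1/M\<close> and by a feasible
  schedule at speed 1 on the tasks with priority at least that of a task \<open>k\<close>. If a task of this
  group lags behind its progress in the feasible schedule at time \<open>t\<close>, let \<open>a\<close> be the start of
  its busy period. It caught up at \<open>a\<close>, so it received less than \<open>(t - a) / s\<close> time since; whenever
  it did not execute, all processors served the group. Hence
  \<open>W t - W a > (s M - (M - 1)) (t - a)\<close>. For \<open>s \<ge> 2 - 1/M\<close> this gives \<open>W \<ge> W'\<close> everywhere, by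
  induction on the number of arrivals (the argument of Phillips, Stein, Torng and Wein).
  If \<open>k\<close> misses a deadline \<open>d\<close>, it lags at \<open>d\<close>, with a busy period of length \<open>L\<close> at least the
  relative deadline of \<open>k\<close>, hence of the whole group. So all work released before \<open>d\<close> is done
  by the feasible schedule by \<open>d + L\<close>, and \<open>W d \<le> W' (d + L) \<le> W' (d - L) + 2 M L
  \<le> W (d - L) + 2 M L < W d\<close>, a contradiction.
\<close>

section \<open>Measures and integrals over half-open time intervals\<close>

lemma measure_lessThan_split:
  fixes S :: "real set"
  assumes "S \<in> sets lborel" "S \<subseteq> {c..}" "a \<le> b"
  shows "measure lborel (S \<inter> {..<b}) = measure lborel (S \<inter> {..<a}) + measure lborel (S \<inter> {a..<b})"
proof -
  \<comment> \<open>\<open>measure\<close> is 0 on sets of infinite measure, so additivity needs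
    finiteness; the lower bound \<open>c\<close> supplies it.\<close>
  have bd: "bounded (S \<inter> {..<x})" for x
    by (rule bounded_subset[of "{c..x}"]) (use assms in auto)
  have fin: "emeasure lborel (S \<inter> {..<x}) \<noteq> \<infinity>" for x
    using emeasure_bounded_finite[OF bd[of x]] by auto
  have fin2: "emeasure lborel (S \<inter> {a..<b}) \<noteq> \<infinity>"
    using emeasure_bounded_finite[of "S \<inter> {a..<b}"]
    by (metis Int_lower2 bounded_Ico bounded_subset infinity_ennreal_def order_less_irrefl)
  have "S \<inter> {..<b} = (S \<inter> {..<a}) \<union> (S \<inter> {a..<b})" using assms(3) by auto
  moreover have "measure lborel ((S \<inter> {..<a}) \<union> (S \<inter> {a..<b}))
      = measure lborel (S \<inter> {..<a}) + measure lborel (S \<inter> {a..<b})"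
    by (rule measure_Union[OF fin fin2]) (use assms(1) in auto)
  ultimately show ?thesis by simp
qed

lemma measure_atLeastLessThan_le:
  fixes S :: "real set"
  assumes "S \<in> sets lborel" "a \<le> b"
  shows "measure lborel (S \<inter> {a..<b}) \<le> b - a"
proof -
  have "measure lborel (S \<inter> {a..<b}) \<le> measure lborel {a..<b}"
    by (rule measure_mono_fmeasurable) (use assms in \<open>auto simp: fmeasurable_def\<close>)
  then show ?thesis using assms by simp
qed

text \<open>Turns service times into integrals, so that counts of executing tasks can be compared
  pointwise.\<close>

lemma integral_indicator_atLeastLessThan:
  fixes S :: "real set"
  assumes "S \<in> sets lborel"
  shows "integrable lborel (indicator (S \<inter> {a..<b}) :: real \<Rightarrow> real)"
    and "integral\<^sup>L lborel (indicator (S \<inter> {a..<b})) = measure lborel (S \<inter> {a..<b})"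
proof -
  have "emeasure lborel (S \<inter> {a..<b}) < \<infinity>"
    using emeasure_bounded_finite[of "S \<inter> {a..<b}"]
    by (metis Int_lower2 bounded_Ico bounded_subset infinity_ennreal_def)
  then show "integrable lborel (indicator (S \<inter> {a..<b}) :: real \<Rightarrow> real)"
    using assms by (intro integrable_real_indicator) auto
qed (use assms in simp)

section \<open>Service received and demand released per task\<close>

definition serving_times :: "nat \<Rightarrow> 'i schedule \<Rightarrow> 'i \<Rightarrow> real set" where
  "serving_times M \<sigma> i = {u. \<exists>j. (i, j) \<in> running M \<sigma> u}"

definition task_time :: "nat \<Rightarrow> 'i schedule \<Rightarrow> 'i \<Rightarrow> real \<Rightarrow> real" where
  "task_time M \<sigma> i t = measure lborel (serving_times M \<sigma> i \<inter> {..<t})"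

text \<open>The strict inequality leaves out jobs arriving at \<open>t\<close> itself, which cannot
  have executed before \<open>t\<close>. At the start of a busy period it counts exactly the earlier
  jobs.\<close>

definition demand :: "'i job_seq \<Rightarrow> 'i \<Rightarrow> real \<Rightarrow> real" where
  "demand J i t = (\<Sum>j | arrival J i j < t. cost J i j)"

section \<open>Valid schedules at any speed, covering both global DM and the feasible
  schedule\<close>

locale schedule_run =
  fixes M :: nat and s :: real and I :: "'i set" and \<tau> :: "'i \<Rightarrow> task"
    and J :: "'i job_seq" and \<sigma> :: "'i schedule"
  assumes tasks: "task_set I \<tau>"
    and legal: "legal I \<tau> J"
    and speed_pos: "0 < s"
    and valid: "valid_schedule M s I J \<sigma>"
begin

lemma finite_tasks: "finite I"
  using tasks by (auto simp: task_set_def)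

lemma period_pos: "i \<in> I \<Longrightarrow> 0 < period (\<tau> i)"
  using tasks by (auto simp: task_set_def)

lemma deadline_pos: "i \<in> I \<Longrightarrow> 0 < deadline (\<tau> i)"
  using tasks by (auto simp: task_set_def)

lemma cost_nonneg: "i \<in> I \<Longrightarrow> 0 \<le> cost J i j"
  using legal by (auto simp: legal_def)

lemma arrival_Suc: "i \<in> I \<Longrightarrow> arrival J i j + period (\<tau> i) \<le> arrival J i (Suc j)"
  using legal by (auto simp: legal_def)

lemma strict_mono_arrival: "i \<in> I \<Longrightarrow> strict_mono (arrival J i)"
  using arrival_Suc period_pos by (intro strict_monoI_Suc) (smt (verit))

lemma arrival_lower: "i \<in> I \<Longrightarrow> arrival J i 0 + real j * period (\<tau> i) \<le> arrival J i j"
proof (induction j)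
  case (Suc j)
  then show ?case using arrival_Suc[of i j] by (auto simp: algebra_simps)
qed simp

text \<open>Arrivals are a positive period apart and so exceed every bound. This makes the sums in
  \<open>demand\<close> genuine finite sums.\<close>

lemma finite_arrived:
  assumes "i \<in> I"
  shows "finite {j. arrival J i j < t}"
proof -
  obtain n :: nat where n: "t - arrival J i 0 < real n * period (\<tau> i)"
    using reals_Archimedean3[OF period_pos[OF assms]] by auto
  have "j < n" if "arrival J i j < t" for j
  proof (rule ccontr)
    assume "\<not> j < n"
    then have "real n * period (\<tau> i) \<le> real j * period (\<tau> i)"
      using period_pos[OF assms] by (intro mult_right_mono) auto
    then show False using arrival_lower[OF assms, of j] n that by linarith
  qed
  then have "{j. arrival J i j < t} \<subseteq> {..<n}" by auto
  then show ?thesis by (rule finite_subset) simp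
qed

lemma running_pending:
  assumes "(i, j) \<in> running M \<sigma> u"
  shows "i \<in> I" "pending M s J \<sigma> i j u" "arrival J i j \<le> u"
proof -
  have "\<forall>(i, j)\<in>running M \<sigma> u. i \<in> I \<and> pending M s J \<sigma> i j u"
    using valid unfolding valid_schedule_def by blast
  then show "i \<in> I" "pending M s J \<sigma> i j u" using assms by auto
  then show "arrival J i j \<le> u" by (simp add: pending_def)
qed

lemma running_unique:
  assumes "(i, j) \<in> running M \<sigma> u" "(i, k) \<in> running M \<sigma> u"
  shows "j = k"
proof -
  obtain p q where pq: "p < M" "q < M" "\<sigma> u p = Some (i, j)" "\<sigma> u q = Some (i, k)"
    using assms by (auto simp: running_def)
  then have "p = q" using valid unfolding valid_schedule_def by blast
  then show ?thesis using pq by simp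
qed

lemma running_sets:
  assumes "i \<in> I"
  shows "{u. (i, j) \<in> running M \<sigma> u} \<in> sets lborel"
proof -
  have "{u. (i, j) \<in> running M \<sigma> u} = (\<Union>p\<in>{..<M}. {u. \<sigma> u p = Some (i, j)})"
    by (auto simp: running_def)
  then show ?thesis using assms valid by (auto simp: valid_schedule_def)
qed

lemma serving_times_eq: "serving_times M \<sigma> i = (\<Union>j. {u. (i, j) \<in> running M \<sigma> u})"
  by (auto simp: serving_times_def)

lemma serving_times_sets: "i \<in> I \<Longrightarrow> serving_times M \<sigma> i \<in> sets lborel"
  unfolding serving_times_eq using running_sets by (intro sets.countable_UN) blast

lemma serving_times_lower: "serving_times M \<sigma> i \<subseteq> {arrival J i 0..}"
proof
  fix u assume "u \<in> serving_times M \<sigma> i"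
  then obtain j where j: "(i, j) \<in> running M \<sigma> u" by (auto simp: serving_times_def)
  have "arrival J i 0 \<le> arrival J i j"
    using strict_mono_arrival[OF running_pending(1)[OF j]]
    by (simp add: strict_mono_less_eq)
  then show "u \<in> {arrival J i 0..}" using running_pending(3)[OF j] by simp
qed

lemma exec_time_eq: "exec_time M J \<sigma> i j t = measure lborel ({u. (i, j) \<in> running M \<sigma> u} \<inter> {..<t})"
  unfolding exec_time_def
  by (rule arg_cong[where f = "measure lborel"]) (auto dest: running_pending(3))

lemma exec_time_diff:
  assumes "i \<in> I" "a \<le> b"
  shows "exec_time M J \<sigma> i j b
    = exec_time M J \<sigma> i j a + measure lborel ({u. (i, j) \<in> running M \<sigma> u} \<inter> {a..<b})"
  unfolding exec_time_eq
  by (rule measure_lessThan_split[OF running_sets[OF assms(1)] _ assms(2), of _ "arrival J i j"])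
    (auto dest: running_pending(3))

lemma exec_time_mono:
  assumes "i \<in> I" "a \<le> b"
  shows "exec_time M J \<sigma> i j a \<le> exec_time M J \<sigma> i j b"
  using exec_time_diff[OF assms] by simp

lemma finished_mono:
  assumes "i \<in> I" "a \<le> b" "finished M s J \<sigma> i j a"
  shows "finished M s J \<sigma> i j b"
  using exec_time_mono[OF assms(1,2), of j] assms(3) by (simp add: finished_def)

text \<open>Only unfinished jobs may execute. Execution time is 1-Lipschitz in \<open>t\<close>, so
  before exceeding the required amount it would equal it at some \<open>x\<close>; the job is
  finished from \<open>x\<close> on and never executes again.\<close>

lemma exec_time_le_cost:
  assumes "i \<in> I"
  shows "exec_time M J \<sigma> i j t \<le> cost J i j / s"
proof (rule ccontr)
  let ?E = "exec_time M J \<sigma> i j" and ?c = "cost J i j / s"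
  assume less: "\<not> ?E t \<le> ?c"
  have E0: "?E u = 0" if "u \<le> arrival J i j" for u
    using that by (simp add: exec_time_def)
  have c0: "0 \<le> ?c" using cost_nonneg[OF assms] speed_pos by simp
  have art: "arrival J i j \<le> t" using less E0[of t] c0 by linarith
  have lip_le: "dist (?E a) (?E b) \<le> 1 * dist a b" if "a \<le> b" for a b
    using exec_time_diff[OF assms that, of j] that
      measure_atLeastLessThan_le[OF running_sets[OF assms] that, of j]
    by (simp add: dist_real_def)
  have lip: "dist (?E x) (?E y) \<le> 1 * dist x y" for x y
    using lip_le[of x y] lip_le[of y x] by (cases "x \<le> y") (simp_all add: dist_commute)
  have "continuous_on {arrival J i j..t} ?E"
    by (rule lipschitz_on_continuous_on[of 1]) (use lip in \<open>auto simp: lipschitz_on_def\<close>)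
  then obtain x where x: "x \<le> t" "?E x = ?c"
    using IVT'[of ?E "arrival J i j" ?c t] less E0[of "arrival J i j"] c0 art by auto
  have "(i, j) \<notin> running M \<sigma> u" if "x \<le> u" for u
  proof
    assume "(i, j) \<in> running M \<sigma> u"
    then have "\<not> finished M s J \<sigma> i j u" using running_pending(2) by (auto simp: pending_def)
    moreover have "finished M s J \<sigma> i j x" by (simp add: finished_def x)
    ultimately show False using finished_mono[OF assms that] by blast
  qed
  then have "{u. (i, j) \<in> running M \<sigma> u} \<inter> {x..<t} = {}" by auto
  then have "?E t = ?E x" using exec_time_diff[OF assms x(1), of j] by (simp del: x)
  then show False using x less by simp
qed

lemma task_time_diff:
  assumes "i \<in> I" "a \<le> b"
  shows "task_time M \<sigma> i b = task_time M \<sigma> i a + measure lborel (serving_times M \<sigma> i \<inter> {a..<b})"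
  unfolding task_time_def
  using measure_lessThan_split[OF serving_times_sets[OF assms(1)] serving_times_lower assms(2)] .

lemma task_time_diff_le:
  assumes "i \<in> I" "a \<le> b"
  shows "task_time M \<sigma> i b - task_time M \<sigma> i a \<le> b - a"
  using task_time_diff[OF assms]
    measure_atLeastLessThan_le[OF serving_times_sets[OF assms(1)] assms(2)] by simp

text \<open>A task executes at most one job at a time, so its service splits into disjoint pieces,
  one per job.\<close>

lemma task_time_eq_sum:
  assumes "i \<in> I"
  shows "task_time M \<sigma> i t = (\<Sum>j | arrival J i j < t. exec_time M J \<sigma> i j t)"
proof -
  let ?A = "\<lambda>j. {u. (i, j) \<in> running M \<sigma> u} \<inter> {..<t}"
  have eq: "serving_times M \<sigma> i \<inter> {..<t} = (\<Union>j\<in>{j. arrival J i j < t}. ?A j)"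
    by (auto simp: serving_times_def dest: running_pending(3))
      (meson le_less_trans running_pending(3))
  have fin: "emeasure lborel (?A j) \<noteq> \<infinity>" for j
  proof -
    have "bounded (?A j)"
      by (rule bounded_subset[of "{arrival J i j..t}"]) (auto dest: running_pending(3))
    then show ?thesis using emeasure_bounded_finite by force
  qed
  have "measure lborel (\<Union>j\<in>{j. arrival J i j < t}. ?A j)
      = (\<Sum>j | arrival J i j < t. measure lborel (?A j))"
  proof (rule measure_finite_Union)
    show "disjoint_family_on ?A {j. arrival J i j < t}"
      by (auto simp: disjoint_family_on_def dest: running_unique)
  qed (use finite_arrived[OF assms] running_sets[OF assms] fin in auto)
  then show ?thesis by (simp add: task_time_def eq exec_time_eq)
qed

lemma task_time_le_demand:
  assumes "i \<in> I"
  shows "s * task_time M \<sigma> i t \<le> demand J i t"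
proof -
  have "task_time M \<sigma> i t \<le> (\<Sum>j | arrival J i j < t. cost J i j / s)"
    unfolding task_time_eq_sum[OF assms] by (intro sum_mono exec_time_le_cost assms)
  also have "\<dots> = demand J i t / s" by (simp add: demand_def sum_divide_distrib)
  finally show ?thesis using speed_pos by (simp add: field_simps)
qed

lemma task_time_ge_cost:
  assumes "i \<in> I" "K \<subseteq> {j. arrival J i j < t}" "\<And>j. j \<in> K \<Longrightarrow> finished M s J \<sigma> i j t"
  shows "sum (cost J i) K \<le> s * task_time M \<sigma> i t"
proof -
  have "sum (cost J i) K / s = (\<Sum>j\<in>K. cost J i j / s)"
    by (simp add: sum_divide_distrib)
  also have "\<dots> \<le> (\<Sum>j\<in>K. exec_time M J \<sigma> i j t)"
    using assms(3) by (intro sum_mono) (auto simp: finished_def)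
  also have "\<dots> \<le> task_time M \<sigma> i t"
    unfolding task_time_eq_sum[OF assms(1)]
    by (intro sum_mono2 finite_arrived assms) (auto simp: exec_time_def)
  finally show ?thesis using speed_pos by (simp add: field_simps)
qed

text \<open>Take the earliest job from whose arrival the task stays active until \<open>t\<close>. A
  job before \<open>j0\<close> still unfinished at the arrival of \<open>j0\<close> would extend
  this active stretch backwards, against minimality.\<close>

lemma busy_period_start:
  assumes "i \<in> I" "arrival J i j < t" "\<not> finished M s J \<sigma> i j t"
  obtains j0 where "j0 \<le> j" "\<And>u. arrival J i j0 \<le> u \<Longrightarrow> u < t \<Longrightarrow> i \<in> active M s I J \<sigma> u"
    "\<And>l. l < j0 \<Longrightarrow> finished M s J \<sigma> i l (arrival J i j0)"
proof -
  let ?Q = "\<lambda>l. \<forall>u. arrival J i l \<le> u \<and> u < t \<longrightarrow> i \<in> active M s I J \<sigma> u"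
  have act: "i \<in> active M s I J \<sigma> u"
    if "\<not> finished M s J \<sigma> i l b" "arrival J i l \<le> u" "u \<le> b" for l u b
    using that finished_mono[OF assms(1) that(3)] assms(1) by (auto simp: active_def pending_def)
  have Qj: "?Q j" using act[OF assms(3)] by auto
  define j0 where "j0 = (LEAST l. ?Q l)"
  have Q: "?Q j0" unfolding j0_def by (rule LeastI[of ?Q, OF Qj])
  have le: "j0 \<le> j" unfolding j0_def by (rule Least_le[of ?Q, OF Qj])
  have fin: "finished M s J \<sigma> i l (arrival J i j0)" if l: "l < j0" for l
  proof (rule ccontr)
    assume n: "\<not> ?thesis"
    have "?Q l"
      using act[OF n] Q by (meson le_less_linear less_imp_le)
    then show False using Least_le[of ?Q l] l unfolding j0_def by auto
  qed
  show ?thesis by (rule that[OF le _ fin]) (use Q in auto)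
qed

text \<open>The sum counts the tasks of \<open>P\<close> being served at \<open>u\<close>; each
  occupies a processor, and a processor serves only one task.\<close>

lemma sum_serving_le:
  assumes "P \<subseteq> I"
  shows "(\<Sum>i\<in>P. indicator (serving_times M \<sigma> i) u) \<le> real M"
proof -
  have finP: "finite P" using assms finite_tasks finite_subset by blast
  have "{i \<in> P. u \<in> serving_times M \<sigma> i} \<subseteq> (\<lambda>p. fst (the (\<sigma> u p))) ` {..<M}"
    by (force simp: serving_times_def running_def)
  then have "card {i \<in> P. u \<in> serving_times M \<sigma> i} \<le> M"
    using surj_card_le[of "{..<M}"] by auto
  then show ?thesis using finP by (simp add: indicator_def sum.If_cases Int_def)
qed

lemma sum_task_time_diff:
  assumes "P \<subseteq> I" "a \<le> b"
  shows "(\<Sum>i\<in>P. task_time M \<sigma> i b) - (\<Sum>i\<in>P. task_time M \<sigma> i a)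
    = integral\<^sup>L lborel (\<lambda>u. \<Sum>i\<in>P. indicator (serving_times M \<sigma> i \<inter> {a..<b}) u)"
proof -
  note S = serving_times_sets[OF subsetD[OF assms(1)]]
  have "integral\<^sup>L lborel (\<lambda>u. \<Sum>i\<in>P. indicator (serving_times M \<sigma> i \<inter> {a..<b}) u :: real)
      = (\<Sum>i\<in>P. measure lborel (serving_times M \<sigma> i \<inter> {a..<b}))"
    by (subst Bochner_Integration.integral_sum)
      (auto intro!: integral_indicator_atLeastLessThan sum.cong S)
  also have "\<dots> = (\<Sum>i\<in>P. task_time M \<sigma> i b - task_time M \<sigma> i a)"
    using assms by (intro sum.cong) (auto simp: task_time_diff)
  finally show ?thesis by (simp add: sum_subtractf)
qed

lemma integrable_sum_serving:
  assumes "P \<subseteq> I"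
  shows "integrable lborel (\<lambda>u. \<Sum>i\<in>P. indicator (serving_times M \<sigma> i \<inter> {a..<b}) u :: real)"
  by (intro Bochner_Integration.integrable_sum integral_indicator_atLeastLessThan
      serving_times_sets subsetD[OF assms])

lemma sum_task_time_diff_le:
  assumes "P \<subseteq> I" "a \<le> b"
  shows "(\<Sum>i\<in>P. task_time M \<sigma> i b) - (\<Sum>i\<in>P. task_time M \<sigma> i a) \<le> real M * (b - a)"
proof -
  note U = integral_indicator_atLeastLessThan[of UNIV a b, simplified]
  have "integral\<^sup>L lborel (\<lambda>u. \<Sum>i\<in>P. indicator (serving_times M \<sigma> i \<inter> {a..<b}) u :: real)
      \<le> integral\<^sup>L lborel (\<lambda>u. real M * indicator {a..<b} u)"
  proof (rule integral_mono[OF integrable_sum_serving[OF assms(1)]])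
    fix u :: real
    have "(\<Sum>i\<in>P. indicator (serving_times M \<sigma> i \<inter> {a..<b}) u)
        = (\<Sum>i\<in>P. indicator (serving_times M \<sigma> i) u) * (indicator {a..<b} u :: real)"
      by (simp add: indicator_inter_arith sum_distrib_right)
    then show "(\<Sum>i\<in>P. indicator (serving_times M \<sigma> i \<inter> {a..<b}) u)
        \<le> real M * indicator {a..<b} u"
      using sum_serving_le[OF assms(1), of u] by (simp add: indicator_def)
  qed (use U in simp)
  also have "\<dots> = real M * (b - a)" using U assms(2) by simp
  finally show ?thesis using sum_task_time_diff[OF assms] by simp
qed

end

section \<open>Fixed-priority scheduling: a waiting task keeps all processors busy\<close>

lemma card_low_rank:
  assumes "finite A" "trans r" "irrefl r" "card {k \<in> A. (k, i) \<in> r} \<ge> M"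
  shows "card {x \<in> A. (x, i) \<in> r \<and> card {k \<in> A. (k, x) \<in> r} < M} \<ge> M"
proof (rule ccontr)
  let ?B = "{k \<in> A. (k, i) \<in> r}"
  let ?S = "{x \<in> A. (x, i) \<in> r \<and> card {k \<in> A. (k, x) \<in> r} < M}"
  assume less: "\<not> card ?S \<ge> M"
  have fin: "finite ?S" "finite ?B" using assms(1) by auto
  have "\<not> ?B \<subseteq> ?S"
    using card_mono[OF fin(1), of ?B] less assms(4) by linarith
  then have ne: "?B - ?S \<noteq> {}" by blast
  \<comment> \<open>Choose an \<open>r\<close>-minimal \<open>x\<close> in \<open>?B - ?S\<close>.
    By transitivity all its predecessors in \<open>A\<close> lie in \<open>?B\<close>, hence in
    \<open>?S\<close> by minimality. They are fewer than \<open>M\<close>, which puts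
    \<open>x\<close> itself into \<open>?S\<close>.\<close>
  have "wf (Restr r A)"
    by (rule finite_acyclic_wf)
      (use assms in \<open>auto simp: acyclic_irrefl trans_Restr irrefl_def\<close>)
  then obtain x where x: "x \<in> ?B - ?S" "\<And>y. (y, x) \<in> Restr r A \<Longrightarrow> y \<notin> ?B - ?S"
    using ne by (rule wfE_min') (rule that)
  have "{k \<in> A. (k, x) \<in> r} \<subseteq> ?S"
  proof
    fix k assume k: "k \<in> {k \<in> A. (k, x) \<in> r}"
    then have "k \<in> ?B" using x(1) assms(2) by (auto dest: transD)
    moreover have "k \<notin> ?B - ?S" using x k by blast
    ultimately show "k \<in> ?S" by blast
  qed
  then have "card {k \<in> A. (k, x) \<in> r} < M"
    using card_mono[OF fin(1)] less by (meson le_less_trans not_le)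
  then show False using x(1) by blast
qed

locale fixed_priority_run = schedule_run M s I \<tau> J \<sigma>
  for M s and I :: "'i set" and \<tau> J \<sigma> +
  fixes r :: "('i \<times> 'i) set" and k :: 'i
  assumes order: "strict_linear_order_on I r"
    and fp: "global_fp r M s I J \<sigma>"
    and processors: "2 \<le> M"
    and task_k: "k \<in> I"
begin

text \<open>\<open>hep\<close> abbreviates higher or equal priority.\<close>

definition hep :: "'i set" where
  "hep = {i \<in> I. i = k \<or> (i, k) \<in> r}"

lemma hep_subset: "hep \<subseteq> I"
  by (auto simp: hep_def)

lemma k_in_hep: "k \<in> hep"
  using task_k by (simp add: hep_def)

lemma trans_r: "trans r" and irrefl_r: "irrefl r"
  using order by (auto simp: strict_linear_order_on_def)

lemma running_fp:
  "running M \<sigma> u = {(i, LEAST j. pending M s J \<sigma> i j u) | i.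
     i \<in> active M s I J \<sigma> u \<and> card {l \<in> active M s I J \<sigma> u. (l, i) \<in> r} < M}"
  using fp unfolding global_fp_def by blast

lemma serving_fp:
  "u \<in> serving_times M \<sigma> i \<longleftrightarrow>
     i \<in> active M s I J \<sigma> u \<and> card {l \<in> active M s I J \<sigma> u. (l, i) \<in> r} < M"
  by (auto simp: serving_times_def running_fp)

text \<open>Jobs of a task are served in arrival order: an earlier job has arrived and lies below
  the least pending index, so it can only be finished.\<close>

lemma running_first_pending:
  assumes "(i, l) \<in> running M \<sigma> u" "j < l"
  shows "finished M s J \<sigma> i j u"
proof -
  have l: "l = (LEAST j. pending M s J \<sigma> i j u)"
    using assms(1) by (auto simp: running_fp)
  have "\<not> pending M s J \<sigma> i j u"
    using assms(2) not_less_Least unfolding l by blast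
  moreover have "arrival J i j \<le> u"
    using strict_monoD[OF strict_mono_arrival[OF running_pending(1)[OF assms(1)]] assms(2)]
      running_pending(3)[OF assms(1)] by linarith
  ultimately show ?thesis by (simp add: pending_def)
qed

text \<open>Two cases in one inequality. If \<open>i\<close> executes, it is itself one served task,
  and the last term adds the other \<open>M - 1\<close>. If it waits, \<open>M\<close> active tasks
  of higher priority execute, and by transitivity they belong to \<open>hep\<close>.\<close>

lemma many_serving:
  assumes "i \<in> hep" "i \<in> active M s I J \<sigma> u"
  shows "real M \<le> (\<Sum>l\<in>hep. indicator (serving_times M \<sigma> l) u)
    + (real M - 1) * indicator (serving_times M \<sigma> i) u"
proof -
  have finite_hep: "finite hep" using hep_subset finite_tasks finite_subset by blast
  have sum: "(\<Sum>l\<in>hep. indicator (serving_times M \<sigma> l) u)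
      = real (card {l \<in> hep. u \<in> serving_times M \<sigma> l})"
    using finite_hep by (simp add: indicator_def sum.If_cases Int_def)
  show ?thesis
  proof (cases "u \<in> serving_times M \<sigma> i")
    case True
    then have "card {l \<in> hep. u \<in> serving_times M \<sigma> l} \<noteq> 0"
      using finite_hep assms(1) by auto
    then show ?thesis using True sum by simp
  next
    case False
    let ?A = "active M s I J \<sigma> u"
    have finA: "finite ?A" using finite_tasks by (simp add: active_def)
    have "card {l \<in> ?A. (l, i) \<in> r} \<ge> M"
      using False assms(2) by (simp add: serving_fp)
    then have "M \<le> card {x \<in> ?A. (x, i) \<in> r \<and> card {l \<in> ?A. (l, x) \<in> r} < M}"
      by (rule card_low_rank[OF finA trans_r irrefl_r])
    also have "\<dots> \<le> card {l \<in> hep. u \<in> serving_times M \<sigma> l}"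
    proof (rule card_mono)
      show "{x \<in> ?A. (x, i) \<in> r \<and> card {l \<in> ?A. (l, x) \<in> r} < M}
          \<subseteq> {l \<in> hep. u \<in> serving_times M \<sigma> l}"
        using assms(1) trans_r by (auto simp: hep_def serving_fp active_def dest: transD)
    qed (use finite_hep in simp)
    finally show ?thesis using False sum by simp
  qed
qed

text \<open>Integral of \<open>many_serving\<close> over the interval: the subtracted term pays for
  the processors that may idle while \<open>i\<close> executes.\<close>

lemma sum_task_time_busy:
  assumes "i \<in> hep" "a \<le> b" "\<And>u. a \<le> u \<Longrightarrow> u < b \<Longrightarrow> i \<in> active M s I J \<sigma> u"
  shows "real M * (b - a) - (real M - 1) * (task_time M \<sigma> i b - task_time M \<sigma> i a)
    \<le> (\<Sum>l\<in>hep. task_time M \<sigma> l b) - (\<Sum>l\<in>hep. task_time M \<sigma> l a)"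
proof -
  have iI: "i \<in> I" using assms(1) hep_subset by blast
  note U = integral_indicator_atLeastLessThan[of UNIV a b, simplified]
  note V = integral_indicator_atLeastLessThan[OF serving_times_sets[OF iI], of a b]
  have "real M * (b - a) - (real M - 1) * measure lborel (serving_times M \<sigma> i \<inter> {a..<b})
      = integral\<^sup>L lborel (\<lambda>u. real M * indicator {a..<b} u
          - (real M - 1) * indicator (serving_times M \<sigma> i \<inter> {a..<b}) u)"
    using U V assms(2) by simp
  also have "\<dots> \<le> integral\<^sup>L lborel
      (\<lambda>u. \<Sum>l\<in>hep. indicator (serving_times M \<sigma> l \<inter> {a..<b}) u)"
  proof (rule integral_mono[OF _ integrable_sum_serving[OF hep_subset]])
    fix u :: real
    have "(\<Sum>l\<in>hep. indicator (serving_times M \<sigma> l \<inter> {a..<b}) u)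
        = (\<Sum>l\<in>hep. indicator (serving_times M \<sigma> l) u) * (indicator {a..<b} u :: real)"
      by (simp add: indicator_inter_arith sum_distrib_right)
    then show "real M * indicator {a..<b} u
          - (real M - 1) * indicator (serving_times M \<sigma> i \<inter> {a..<b}) u
        \<le> (\<Sum>l\<in>hep. indicator (serving_times M \<sigma> l \<inter> {a..<b}) u)"
      using many_serving[OF assms(1) assms(3), of u]
      by (cases "u \<in> {a..<b}") (simp_all add: indicator_inter_arith)
  qed (use U V in simp)
  finally show ?thesis
    using sum_task_time_diff[OF hep_subset assms(2)] task_time_diff[OF iI assms(2)] by simp
qed

end

section \<open>Comparison with a speed-1 schedule of the same jobs\<close>

locale fixed_priority_comparison =
  fixed_priority_run M s I \<tau> J \<sigma> r k + opt: schedule_run M 1 I \<tau> J \<sigma>'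
  for M s and I :: "'i set" and \<tau> J \<sigma> r k \<sigma>'
begin

lemma lagging_busy_period:
  assumes "i \<in> hep" "arrival J i j < t" "\<not> finished M s J \<sigma> i j t"
    and lag: "s * task_time M \<sigma> i t < task_time M \<sigma>' i t"
  obtains j0 where "j0 \<le> j"
    "s * (\<Sum>l\<in>hep. task_time M \<sigma> l t) - s * (\<Sum>l\<in>hep. task_time M \<sigma> l (arrival J i j0))
      > (s * real M - (real M - 1)) * (t - arrival J i j0)"
proof -
  have iI: "i \<in> I" using assms(1) hep_subset by blast
  obtain j0 where j0: "j0 \<le> j"
    and busy: "\<And>u. arrival J i j0 \<le> u \<Longrightarrow> u < t \<Longrightarrow> i \<in> active M s I J \<sigma> u"
    and fin: "\<And>l. l < j0 \<Longrightarrow> finished M s J \<sigma> i l (arrival J i j0)"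
    using busy_period_start[OF iI assms(2,3)] by blast
  define a where "a = arrival J i j0"
  have at: "a \<le> t"
    using j0 strict_mono_arrival[OF iI] assms(2) unfolding a_def
    by (meson le_less_trans less_imp_le strict_mono_less_eq)
  \<comment> \<open>At \<open>a\<close> every earlier job of \<open>i\<close> is finished, so the
    whole demand has been served and \<open>\<sigma>'\<close> cannot be ahead.\<close>
  have "task_time M \<sigma>' i a \<le> demand J i a"
    using opt.task_time_le_demand[OF iI, of a] by simp
  also have "\<dots> \<le> s * task_time M \<sigma> i a"
    unfolding demand_def
  proof (rule task_time_ge_cost[OF iI order_refl])
    fix l assume "l \<in> {l. arrival J i l < a}"
    then have "l < j0"
      using strict_mono_less[OF strict_mono_arrival[OF iI]] by (simp add: a_def)
    then show "finished M s J \<sigma> i l a" using fin by (simp add: a_def)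
  qed
  finally have "s * (task_time M \<sigma> i t - task_time M \<sigma> i a) < t - a"
    using lag opt.task_time_diff_le[OF iI at] by (simp add: algebra_simps)
  \<comment> \<open>\<open>M \<ge> 2\<close> makes the factor positive, so the strictness of the lag
    survives.\<close>
  then have "(real M - 1) * (s * (task_time M \<sigma> i t - task_time M \<sigma> i a)) < (real M - 1) * (t - a)"
    using processors by (intro mult_strict_left_mono) auto
  moreover have "s * (real M * (t - a) - (real M - 1) * (task_time M \<sigma> i t - task_time M \<sigma> i a))
      \<le> s * ((\<Sum>l\<in>hep. task_time M \<sigma> l t) - (\<Sum>l\<in>hep. task_time M \<sigma> l a))"
    using sum_task_time_busy[OF assms(1) at] busy speed_pos
    by (intro mult_left_mono) (auto simp: a_def)
  ultimately have "s * (\<Sum>l\<in>hep. task_time M \<sigma> l t) - s * (\<Sum>l\<in>hep. task_time M \<sigma> l a)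
      > (s * real M - (real M - 1)) * (t - a)"
    by (simp add: algebra_simps)
  then show ?thesis using that j0 unfolding a_def by blast
qed

lemma work_dominates:
  assumes speed: "s \<ge> 2 - 1 / real M"
  shows "(\<Sum>i\<in>hep. task_time M \<sigma>' i t) \<le> s * (\<Sum>i\<in>hep. task_time M \<sigma> i t)"
proof (induction "card (SIGMA i:hep. {j. arrival J i j < t})" arbitrary: t rule: less_induct)
  case less
  have finite_hep: "finite hep" using hep_subset finite_tasks finite_subset by blast
  show ?case
  proof (cases "\<exists>i\<in>hep. s * task_time M \<sigma> i t < task_time M \<sigma>' i t")
    case False
    then show ?thesis by (auto simp: sum_distrib_left not_less intro!: sum_mono)
  next
    case True
    then obtain i where i: "i \<in> hep" "s * task_time M \<sigma> i t < task_time M \<sigma>' i t" by blast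
    have iI: "i \<in> I" using i(1) hep_subset by blast
    \<comment> \<open>Were all arrived jobs finished, \<open>i\<close> would have done its full
      demand and could not lag.\<close>
    obtain j where j: "arrival J i j < t" "\<not> finished M s J \<sigma> i j t"
    proof (rule ccontr)
      assume "\<not> thesis"
      then have "demand J i t \<le> s * task_time M \<sigma> i t"
        unfolding demand_def using that by (intro task_time_ge_cost[OF iI order_refl]) auto
      then show False using i(2) opt.task_time_le_demand[OF iI, of t] by simp
    qed
    obtain j0 where j0: "j0 \<le> j"
      and work: "s * (\<Sum>l\<in>hep. task_time M \<sigma> l t) - s * (\<Sum>l\<in>hep. task_time M \<sigma> l (arrival J i j0))
        > (s * real M - (real M - 1)) * (t - arrival J i j0)"
      using lagging_busy_period[OF i(1) j i(2)] by blast
    have lt: "arrival J i j0 < t"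
      using j0 j(1) strict_mono_less_eq[OF strict_mono_arrival[OF iI]]
      by (meson le_less_trans)
    \<comment> \<open>Job \<open>j0\<close> arrives before \<open>t\<close> but not before its own
      arrival, so the count drops and the induction hypothesis applies at the start of the busy
      period.\<close>
    have "card (SIGMA l:hep. {j. arrival J l j < arrival J i j0})
        < card (SIGMA l:hep. {j. arrival J l j < t})"
    proof (rule psubset_card_mono)
      show "finite (SIGMA l:hep. {j. arrival J l j < t})"
        using finite_hep hep_subset finite_arrived by (intro finite_SigmaI) auto
      have "(i, j0) \<in> (SIGMA l:hep. {j. arrival J l j < t})"
        using lt i(1) by simp
      moreover have "(i, j0) \<notin> (SIGMA l:hep. {j. arrival J l j < arrival J i j0})" by simp
      moreover have "(SIGMA l:hep. {j. arrival J l j < arrival J i j0})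
          \<subseteq> (SIGMA l:hep. {j. arrival J l j < t})" using lt by auto
      ultimately show "(SIGMA l:hep. {j. arrival J l j < arrival J i j0})
          \<subset> (SIGMA l:hep. {j. arrival J l j < t})" by blast
    qed
    note IH = less[OF this]
    \<comment> \<open>The speed makes the group progress at average rate at least \<open>M\<close>
      since then, which is the most that \<open>\<sigma>'\<close> can achieve.\<close>
    have "s * real M \<ge> 2 * real M - 1"
      using speed processors by (simp add: field_simps)
    then have "(s * real M - (real M - 1)) * (t - arrival J i j0) \<ge> real M * (t - arrival J i j0)"
      using lt by (intro mult_right_mono) auto
    then show ?thesis
      using work IH opt.sum_task_time_diff_le[OF hep_subset, of "arrival J i j0" t] lt by linarith
  qed
qed

lemma meets_deadline:
  assumes speed: "s \<ge> 3 - 1 / real M"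
    and shorter: "\<And>i. i \<in> hep \<Longrightarrow> deadline (\<tau> i) \<le> deadline (\<tau> k)"
    and opt_meets: "meets_deadlines M 1 I \<tau> J \<sigma>'"
  shows "finished M s J \<sigma> k j (arrival J k j + deadline (\<tau> k))"
proof (rule ccontr)
  define d where "d = arrival J k j + deadline (\<tau> k)"
  assume "\<not> ?thesis"
  then have unfin: "\<not> finished M s J \<sigma> k j d" by (simp add: d_def)
  have arr: "arrival J k j < d" using deadline_pos[OF task_k] by (simp add: d_def)
  note mono_k = strict_mono_less_eq[OF strict_mono_arrival[OF task_k]]
  \<comment> \<open>With deadlines longer than periods, later jobs of \<open>k\<close> may have
    arrived before \<open>d\<close>. They wait for job \<open>j\<close>, still unfinished at
    \<open>d\<close>, so only jobs up to \<open>j\<close> have received time.\<close>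
  have "task_time M \<sigma> k d = (\<Sum>l\<le>j. exec_time M J \<sigma> k l d)"
    unfolding task_time_eq_sum[OF task_k]
  proof (rule sum.mono_neutral_right[OF finite_arrived[OF task_k]])
    show "{..j} \<subseteq> {l. arrival J k l < d}"
      using arr mono_k by (auto intro: le_less_trans)
    show "\<forall>l\<in>{l. arrival J k l < d} - {..j}. exec_time M J \<sigma> k l d = 0"
    proof
      fix l assume "l \<in> {l. arrival J k l < d} - {..j}"
      then have jl: "j < l" by simp
      have "(k, l) \<notin> running M \<sigma> u" if "u < d" for u
        using running_first_pending[OF _ jl] finished_mono[OF task_k less_imp_le[OF that]] unfin
        by blast
      then have "{u. (k, l) \<in> running M \<sigma> u} \<inter> {..<d} = {}" by auto
      then show "exec_time M J \<sigma> k l d = 0" by (simp add: exec_time_eq)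
    qed
  qed
  also have "\<dots> < (\<Sum>l\<le>j. cost J k l / s)"
    using exec_time_le_cost[OF task_k] unfin
    by (intro sum_strict_mono_ex1) (auto simp: finished_def not_le)
  also have "\<dots> = (\<Sum>l\<le>j. cost J k l) / s" by (simp add: sum_divide_distrib)
  finally have "s * task_time M \<sigma> k d < (\<Sum>l\<le>j. cost J k l)"
    using speed_pos by (simp add: field_simps)
  also have "\<dots> \<le> 1 * task_time M \<sigma>' k d"
  proof (rule opt.task_time_ge_cost[OF task_k])
    show "{..j} \<subseteq> {l. arrival J k l < d}"
      using arr mono_k by (auto intro: le_less_trans)
    fix l assume "l \<in> {..j}"
    then have "arrival J k l + deadline (\<tau> k) \<le> d" using mono_k by (simp add: d_def)
    then show "finished M 1 J \<sigma>' k l d"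
      using opt.finished_mono[OF task_k] opt_meets task_k unfolding meets_deadlines_def by blast
  qed
  finally have lag: "s * task_time M \<sigma> k d < task_time M \<sigma>' k d" by simp
  obtain j0 where j0: "j0 \<le> j"
    and work: "s * (\<Sum>l\<in>hep. task_time M \<sigma> l d) - s * (\<Sum>l\<in>hep. task_time M \<sigma> l (arrival J k j0))
      > (s * real M - (real M - 1)) * (d - arrival J k j0)"
    using lagging_busy_period[OF k_in_hep arr unfin lag] by blast
  \<comment> \<open>The busy period starts no later than the arrival of job \<open>j\<close>, hence
    its length is at least the deadline of \<open>k\<close>.\<close>
  define L where "L = d - arrival J k j0"
  have deadline_L: "deadline (\<tau> k) \<le> L"
    using j0 mono_k[of j0 j] by (simp add: L_def d_def)
  then have L_pos: "0 < L" using deadline_pos[OF task_k] by linarith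
  \<comment> \<open>Group jobs released before \<open>d\<close> have relative deadlines at most
    \<open>L\<close>, so \<open>\<sigma>'\<close> has completed all of them by
    \<open>d + L\<close>.\<close>
  have "s * (\<Sum>i\<in>hep. task_time M \<sigma> i d) \<le> (\<Sum>i\<in>hep. task_time M \<sigma>' i (d + L))"
    unfolding sum_distrib_left
  proof (rule sum_mono)
    fix i assume i: "i \<in> hep"
    then have iI: "i \<in> I" using hep_subset by blast
    have "s * task_time M \<sigma> i d \<le> demand J i d" by (rule task_time_le_demand[OF iI])
    also have "\<dots> \<le> 1 * task_time M \<sigma>' i (d + L)"
      unfolding demand_def
    proof (rule opt.task_time_ge_cost[OF iI])
      show "{j. arrival J i j < d} \<subseteq> {j. arrival J i j < d + L}" using L_pos by auto
      fix l assume "l \<in> {j. arrival J i j < d}"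
      then have "arrival J i l + deadline (\<tau> i) \<le> d + L"
        using shorter[OF i] deadline_L by simp
      then show "finished M 1 J \<sigma>' i l (d + L)"
        using opt.finished_mono[OF iI] opt_meets iI unfolding meets_deadlines_def by blast
    qed
    finally show "s * task_time M \<sigma> i d \<le> task_time M \<sigma>' i (d + L)" by simp
  qed
  also have "\<dots> \<le> (\<Sum>i\<in>hep. task_time M \<sigma>' i (d - L)) + 2 * real M * L"
    using opt.sum_task_time_diff_le[OF hep_subset, of "d - L" "d + L"] L_pos by simp
  \<comment> \<open>\<open>d - L\<close> is the start of the busy period; dominance is applied
    there.\<close>
  also have "\<dots> \<le> s * (\<Sum>i\<in>hep. task_time M \<sigma> i (d - L)) + 2 * real M * L"
    using work_dominates[of "d - L"] speed by simp
  also have "\<dots> \<le> s * (\<Sum>i\<in>hep. task_time M \<sigma> i (d - L)) + (s * real M - (real M - 1)) * L"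
  proof -
    \<comment> \<open>This is where \<open>3 - 1 / real M\<close> comes from: the busy period must
      do the work of \<open>\<sigma>'\<close> over an interval of length
      \<open>2 * L\<close>.\<close>
    have "2 * real M \<le> s * real M - (real M - 1)"
      using speed processors by (simp add: field_simps)
    then show ?thesis using L_pos by (intro add_left_mono mult_right_mono) auto
  qed
  also have "\<dots> < s * (\<Sum>i\<in>hep. task_time M \<sigma> i d)"
    using work by (simp add: L_def)
  finally show False by simp
qed

end

theorem theorem5p2:
  fixes M :: nat
  assumes "M \<ge> 2"
  shows "speedup_bound (global_dm :: 'i algorithm) M (3 - 1 / real M)"
proof -
  let ?s = "3 - 1 / real M"
  have s_pos: "0 < ?s" using assms by (simp add: field_simps)
  have "finished M ?s J \<sigma> k j (arrival J k j + deadline (\<tau> k))"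
    if tasks: "task_set I \<tau>" and feas: "feasible M 1 I \<tau>" and legal: "legal I \<tau> J"
      and dm: "global_dm M ?s I \<tau> J \<sigma>" and k: "k \<in> I"
    for I :: "'i set" and \<tau> J \<sigma> k j
  proof -
    obtain r where r: "dm_priority I \<tau> r" "global_fp r M ?s I J \<sigma>"
      using dm by (auto simp: global_dm_def)
    \<comment> \<open>Feasibility is used for the very job sequence that DM serves, with its actual
      costs.\<close>
    obtain \<sigma>' where opt: "valid_schedule M 1 I J \<sigma>'" "meets_deadlines M 1 I \<tau> J \<sigma>'"
      using feas legal by (auto simp: feasible_def)
    interpret fixed_priority_comparison M ?s I \<tau> J \<sigma> r k \<sigma>'
      using tasks legal k r opt s_pos assms
      by unfold_locales (auto simp: dm_priority_def global_fp_def)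
    show ?thesis
    proof (rule meets_deadline[OF order_refl _ opt(2)])
      fix i assume "i \<in> hep"
      \<comment> \<open>By asymmetry \<open>k\<close> does not precede \<open>i\<close>, so its
        deadline cannot be strictly smaller, however ties are broken.\<close>
      then have "i \<in> I" "(k, i) \<notin> r"
        using trans_r irrefl_r by (auto simp: hep_def irrefl_def dest: transD)
      then show "deadline (\<tau> i) \<le> deadline (\<tau> k)"
        using r(1) k unfolding dm_priority_def by (meson not_le)
    qed
  qed
  then show ?thesis
    unfolding speedup_bound_def alg_meets_deadlines_def meets_deadlines_def by blast
qed

end
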